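(* Let $G$ be a digraph, $l\geq 0$ an integer, and let $\mathcal{T}$ be a set of tangles in $G$, each of order $>l$, such that every two distinct tangles in $\mathcal{T}$ are $l$-distinguishable but not $(l-1)$-distinguishable. Then there is a tree-labelling $(L,\beta,\gamma)$ of $\mathcal{T}$ such that $|\gamma(e)|=l$ for all $e\in E(L)$. Here a tree-labelling of $\mathcal{T}$ is a triple $(L,\beta,\gamma)$ where $L$ is a tree, $\beta:V(L)\to\mathcal{T}$ and $\gamma:E(L)\to\mathcal{S}(G)$ are functions such that (1) $\beta$ is a bijection between $V(L)$ and $\mathcal{T}$; (2) if $t\neq t'\in V(L)$ and $P$ is the path in $L$ between $t$ and $t'$, then for every $e\in E(P)$ with $|\gamma(e)|=\min\{|\gamma(e')|:e'\in E(P)\}$, $\gamma(e)$ is a minimum order distinguisher between $\beta(t)$ and $\beta(t')$; (3) for every $e=\{s,s'\}\in E(L)$ there are $t$ in the component of $L-e$ containing $s$ and $t'$ in the component of $L-e$ containing $s'$ such that $\gamma(e)$ is a minimum order distinguisher of $\beta(t)$ and $\beta(t')$.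
   Context: All graphs are finite digraphs. A directed separation of $G$ is a pair $(A,B)$ of subgraphs of $G$ with $V(A)\cup V(B)=V(G)$ such that either no edge has tail in $V(A)\setminus V(B)$ and head in $V(B)\setminus V(A)$, or no edge has tail in $V(B)\setminus V(A)$ and head in $V(A)\setminus V(B)$; its order $|(A,B)|$ is $|V(A)\cap V(B)|$; $\mathcal{S}(G)$ is the set of all directed separations of $G$. A tangle of order $k$ in $G$ is a set $\mathcal{T}$ of directed separations of order $<k$ such that (i) for every directed separation $(A,B)$ of order $<k$, $(A,B)\in\mathcal{T}$ or $(B,A)\in\mathcal{T}$, and (ii) for all $(A_1,B_1),(A_2,B_2),(A_3,B_3)\in\mathcal{T}$, $V(A_1)\cup V(A_2)\cup V(A_3)\neq V(G)$. A separation $(A,B)$ distinguishes tangles $T,T'$ if one of them contains $(A,B)$ and the other contains $(B,A)$; $T,T'$ are $j$-distinguishable if some separation of order $j$ distinguishes them. A minimum order distinguisher of $T,T'$ is a distinguisher of smallest possible order. *)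

theory Defs
  imports "Graph_Theory.Digraph_Component"
begin

section \<open>Directed separations and tangles\<close>

type_synonym ('a, 'b) dsep = "('a, 'b) pre_digraph \<times> ('a, 'b) pre_digraph"

definition dseps :: "('a, 'b) pre_digraph \<Rightarrow> ('a, 'b) dsep set" where
  "dseps G = {(A, B). subgraph A G \<and> subgraph B G \<and> verts A \<union> verts B = verts G \<and>
     ((\<forall>e \<in> arcs G. \<not> (tail G e \<in> verts A - verts B \<and> head G e \<in> verts B - verts A)) \<or>
      (\<forall>e \<in> arcs G. \<not> (tail G e \<in> verts B - verts A \<and> head G e \<in> verts A - verts B)))}"

definition sep_order :: "('a, 'b) dsep \<Rightarrow> nat" where
  "sep_order S = card (verts (fst S) \<inter> verts (snd S))"

definition is_tangle :: "('a, 'b) pre_digraph \<Rightarrow> nat \<Rightarrow> ('a, 'b) dsep set \<Rightarrow> bool" where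
  "is_tangle G k T \<longleftrightarrow>
     T \<subseteq> {S \<in> dseps G. sep_order S < k} \<and>
     (\<forall>A B. (A, B) \<in> dseps G \<longrightarrow> sep_order (A, B) < k \<longrightarrow> (A, B) \<in> T \<or> (B, A) \<in> T) \<and>
     (\<forall>A1 B1 A2 B2 A3 B3. (A1, B1) \<in> T \<longrightarrow> (A2, B2) \<in> T \<longrightarrow> (A3, B3) \<in> T \<longrightarrow>
        verts A1 \<union> verts A2 \<union> verts A3 \<noteq> verts G)"

definition distinguishes :: "('a, 'b) dsep \<Rightarrow> ('a, 'b) dsep set \<Rightarrow> ('a, 'b) dsep set \<Rightarrow> bool" where
  "distinguishes S T T' \<longleftrightarrow>
     (S \<in> T \<and> prod.swap S \<in> T') \<or> (S \<in> T' \<and> prod.swap S \<in> T)"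

text \<open>The order \<open>j\<close> is an integer, so that \<open>(l - 1)\<close>-distinguishability also makes sense for
  \<open>l = 0\<close>, where it never holds.\<close>

definition distinguishable ::
  "('a, 'b) pre_digraph \<Rightarrow> int \<Rightarrow> ('a, 'b) dsep set \<Rightarrow> ('a, 'b) dsep set \<Rightarrow> bool" where
  "distinguishable G j T T' \<longleftrightarrow>
     (\<exists>S \<in> dseps G. int (sep_order S) = j \<and> distinguishes S T T')"

definition min_distinguisher ::
  "('a, 'b) pre_digraph \<Rightarrow> ('a, 'b) dsep \<Rightarrow> ('a, 'b) dsep set \<Rightarrow> ('a, 'b) dsep set \<Rightarrow> bool" where
  "min_distinguisher G S T T' \<longleftrightarrow>
     S \<in> dseps G \<and> distinguishes S T T' \<and>
     (\<forall>S' \<in> dseps G. distinguishes S' T T' \<longrightarrow> sep_order S \<le> sep_order S')"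


section \<open>Undirected trees\<close>

text \<open>Finite simple undirected graphs with vertex set \<open>V\<close> and edge set \<open>E\<close>, every edge being a
  two-element set of vertices. The predicate \<open>Digraph_Component.tree\<close> is not suitable here: it only
  excludes directed cycles, so it holds of a transitive triangle.\<close>

definition usimple_graph :: "'v set \<Rightarrow> 'v set set \<Rightarrow> bool" where
  "usimple_graph V E \<longleftrightarrow> finite V \<and> (\<forall>e \<in> E. e \<subseteq> V \<and> card e = 2)"

definition walk_edges :: "'v list \<Rightarrow> 'v set set" where
  "walk_edges p = {{p ! i, p ! Suc i} | i. Suc i < length p}"

definition upath :: "'v set \<Rightarrow> 'v set set \<Rightarrow> 'v \<Rightarrow> 'v list \<Rightarrow> 'v \<Rightarrow> bool" where
  "upath V E s p t \<longleftrightarrow> p \<noteq> [] \<and> hd p = s \<and> last p = t \<and> distinct p \<and>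
     set p \<subseteq> V \<and> walk_edges p \<subseteq> E"

definition ucycle :: "'v set \<Rightarrow> 'v set set \<Rightarrow> 'v list \<Rightarrow> bool" where
  "ucycle V E p \<longleftrightarrow> length p \<ge> 3 \<and> distinct p \<and> set p \<subseteq> V \<and>
     walk_edges p \<subseteq> E \<and> {last p, hd p} \<in> E"

definition ucomponent :: "'v set \<Rightarrow> 'v set set \<Rightarrow> 'v \<Rightarrow> 'v set" where
  "ucomponent V E s = {t. \<exists>p. upath V E s p t}"

text \<open>The null graph counts as a tree. In a tree-labelling of a set \<open>TT\<close> of tangles the vertices are
  in bijection with \<open>TT\<close>, so this only matters if \<open>TT\<close> is empty.\<close>

definition utree :: "'v set \<Rightarrow> 'v set set \<Rightarrow> bool" where
  "utree V E \<longleftrightarrow> usimple_graph V E \<and>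
     (\<forall>s \<in> V. \<forall>t \<in> V. \<exists>p. upath V E s p t) \<and> (\<nexists>p. ucycle V E p)"


section \<open>Tree-labellings\<close>

text \<open>The tree is \<open>L = (V, E)\<close>. In the second-to-last conjunct, \<open>p\<close> ranges over all paths of \<open>L\<close>
  between \<open>t\<close> and \<open>t'\<close>; as \<open>L\<close> is a tree, there is exactly one.\<close>

definition tree_labelling ::
  "('a, 'b) pre_digraph \<Rightarrow> ('a, 'b) dsep set set \<Rightarrow> 'v set \<Rightarrow> 'v set set \<Rightarrow>
   ('v \<Rightarrow> ('a, 'b) dsep set) \<Rightarrow> ('v set \<Rightarrow> ('a, 'b) dsep) \<Rightarrow> bool" where
  "tree_labelling G TT V E \<beta> \<gamma> \<longleftrightarrow>
     utree V E \<and>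
     (\<forall>e \<in> E. \<gamma> e \<in> dseps G) \<and>
     bij_betw \<beta> V TT \<and>
     (\<forall>t \<in> V. \<forall>t' \<in> V. \<forall>p. t \<noteq> t' \<longrightarrow> upath V E t p t' \<longrightarrow>
        (\<forall>e \<in> walk_edges p.
           sep_order (\<gamma> e) = Min {sep_order (\<gamma> e') | e'. e' \<in> walk_edges p} \<longrightarrow>
           min_distinguisher G (\<gamma> e) (\<beta> t) (\<beta> t'))) \<and>
     (\<forall>s s'. {s, s'} \<in> E \<longrightarrow>
        (\<exists>t \<in> ucomponent V (E - {{s, s'}}) s. \<exists>t' \<in> ucomponent V (E - {{s, s'}}) s'.
           min_distinguisher G (\<gamma> {s, s'}) (\<beta> t) (\<beta> t')))"

end

theory Submission
  imports Defs
begin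

text \<open>Orient every separation \<open>(A, B)\<close> of order \<open>l\<close> so that no edge leads from \<open>A - B\<close> to
  \<open>B - A\<close>, and let \<open>F\<close> be the family of all sets of those tangles that contain a given separation.
  The corners \<open>(A \<union> C, B \<inter> D)\<close> and \<open>(A \<inter> C, B \<union> D)\<close> of two such separations are again oriented in
  this way. If the two sets of tangles cross, both corners distinguish some pair of tangles, hence
  have order at least \<open>l\<close>, and by submodularity exactly \<open>l\<close>. So \<open>F\<close> is closed under intersections
  and unions of crossing sets, and uncrossing shows that a maximal nested subfamily still separates
  any two tangles. Let \<open>M\<close> be a smallest nested separating subfamily. By minimality each \<open>X \<in> M\<close>
  comes with a pair of tangles separated by \<open>X\<close> and by no other member of \<open>M\<close>; nestedness makes
  these pairs the edges of a connected graph, in which the cut given by \<open>X\<close> consists of a single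
  edge. Therefore the graph is a tree.\<close>

section \<open>Crossing families\<close>

text \<open>For subsets of \<open>V\<close>, all four corners of the bipartitions given by
  \<open>X\<close> and \<open>Y\<close> are nonempty. Complementing either set in \<open>V\<close>
  merely permutes these corners.\<close>

definition crossing :: "'v set \<Rightarrow> 'v set \<Rightarrow> 'v set \<Rightarrow> bool" where
  "crossing V X Y \<longleftrightarrow> X \<inter> Y \<noteq> {} \<and> X - Y \<noteq> {} \<and> Y - X \<noteq> {} \<and> X \<union> Y \<noteq> V"

definition nested_family :: "'v set \<Rightarrow> 'v set set \<Rightarrow> bool" where
  "nested_family V N \<longleftrightarrow> (\<forall>X \<in> N. \<forall>Y \<in> N. \<not> crossing V X Y)"

definition separating_family :: "'v set \<Rightarrow> 'v set set \<Rightarrow> bool" where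
  "separating_family V N \<longleftrightarrow> (\<forall>u \<in> V. \<forall>v \<in> V. u \<noteq> v \<longrightarrow> (\<exists>X \<in> N. (u \<in> X) \<noteq> (v \<in> X)))"

section \<open>Corners and complements of crossing sets\<close>

lemma crossing_sym: "crossing V X Y \<longleftrightarrow> crossing V Y X"
  by (auto simp: crossing_def Int_commute Un_commute)

text \<open>Ensures that uncrossing creates no new crossings. If \<open>W\<close> crosses
  \<open>X \<inter> Y\<close> but neither \<open>X\<close> nor \<open>Y\<close>, then each of
  \<open>X\<close> and \<open>Y\<close> contains \<open>W\<close> or covers \<open>V\<close>
  together with it, and every combination fails.\<close>

lemma crossing_InterD:
  assumes "X \<subseteq> V" "Y \<subseteq> V" "W \<subseteq> V" "crossing V X Y" "\<not> crossing V Y W" "crossing V (X \<inter> Y) W"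
  shows "crossing V X W"
proof (rule ccontr)
  assume "\<not> crossing V X W"
  then have X: "W \<subseteq> X \<or> V \<subseteq> X \<union> W"
    using assms(6) unfolding crossing_def by auto
  have Y: "W \<subseteq> Y \<or> V \<subseteq> Y \<union> W"
    using assms(5,6) unfolding crossing_def by auto
  obtain v where "v \<in> V" "v \<notin> X" "v \<notin> Y"
    using assms(1,2,4) unfolding crossing_def by auto
  moreover obtain w where "w \<in> W" "w \<notin> X \<inter> Y"
    using assms(6) unfolding crossing_def by auto
  moreover obtain z where "z \<in> V" "z \<notin> X \<inter> Y" "z \<notin> W"
    using assms(1,3,6) unfolding crossing_def by auto
  \<comment> \<open>\<open>w\<close> excludes that \<open>W\<close> lies in both sets,
    \<open>z\<close> that it covers \<open>V\<close> with each of them, and \<open>v\<close> the two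
    mixed cases.\<close>
  ultimately show False
    using X Y by blast
qed

lemma crossing_compl:
  assumes "X \<subseteq> V" "Y \<subseteq> V"
  shows "crossing V (V - X) Y \<longleftrightarrow> crossing V X Y"
proof -
  have "(V - X) \<inter> Y = Y - X" "Y - (V - X) = X \<inter> Y" "V - X - Y \<noteq> {} \<longleftrightarrow> X \<union> Y \<noteq> V"
    "(V - X) \<union> Y \<noteq> V \<longleftrightarrow> X - Y \<noteq> {}"
    using assms by auto
  then show ?thesis
    unfolding crossing_def by simp blast
qed

text \<open>Dual to \<open>crossing_InterD\<close>: pass to complements in \<open>V\<close>, which
  preserves crossing.\<close>

lemma crossing_UnionD:
  assumes "X \<subseteq> V" "Y \<subseteq> V" "W \<subseteq> V" "crossing V X Y" "\<not> crossing V Y W" "crossing V (X \<union> Y) W"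
  shows "crossing V X W"
proof -
  have "V - (X \<union> Y) = (V - X) \<inter> (V - Y)"
    by blast
  then have "crossing V ((V - X) \<inter> (V - Y)) W"
    using crossing_compl[of "X \<union> Y" V W] assms by simp
  moreover have "crossing V (V - X) (V - Y)"
    using crossing_compl[of X V "V - Y"] crossing_compl[of Y V X] crossing_sym[of V X] assms
    by simp
  moreover have "\<not> crossing V (V - Y) W"
    using crossing_compl[of Y V W] assms by simp
  ultimately have "crossing V (V - X) W"
    using crossing_InterD[of "V - X" V "V - Y" W] assms by simp
  then show ?thesis
    using crossing_compl[of X V W] assms by simp
qed

lemma not_crossing_corner: "\<not> crossing V (X \<inter> Y) Y" "\<not> crossing V (X \<union> Y) Y"
  by (auto simp: crossing_def)

text \<open>If a maximal nested \<open>N\<close> fails to separate \<open>u\<close> from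
  \<open>v\<close>, choose \<open>Z\<close> in \<open>F\<close> that separates them and crosses as
  few members of \<open>N\<close> as possible. Replacing \<open>Z\<close> by a corner with a crossed
  member lowers this number.\<close>

lemma maximal_nested_separating:
  assumes fin: "finite V" and F: "F \<subseteq> Pow V" and sep: "separating_family V F"
    and closed: "\<And>X Y. X \<in> F \<Longrightarrow> Y \<in> F \<Longrightarrow> crossing V X Y \<Longrightarrow> X \<inter> Y \<in> F \<and> X \<union> Y \<in> F"
  shows "\<exists>N \<subseteq> F. nested_family V N \<and> separating_family V N"
proof -
  have finF: "finite F"
    using fin F by (meson finite_Pow_iff finite_subset)
  have "finite {N. N \<subseteq> F \<and> nested_family V N}"
    using finF by (auto intro: finite_subset[of _ "Pow F"])
  moreover have "{} \<in> {N. N \<subseteq> F \<and> nested_family V N}"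
    by (simp add: nested_family_def)
  ultimately obtain N where N: "N \<subseteq> F" "nested_family V N"
    and maxN: "\<And>N'. N' \<subseteq> F \<Longrightarrow> nested_family V N' \<Longrightarrow> N \<subseteq> N' \<Longrightarrow> N' = N"
    using finite_has_maximal[of "{N. N \<subseteq> F \<and> nested_family V N}"]
    by (metis (no_types, lifting) empty_iff mem_Collect_eq)
  have finN: "finite N"
    using N(1) finF finite_subset by blast
  have "separating_family V N"
  proof (rule ccontr)
    assume "\<not> separating_family V N"
    then obtain u v where uv: "u \<in> V" "v \<in> V" "u \<noteq> v"
      and same: "\<And>X. X \<in> N \<Longrightarrow> u \<in> X \<longleftrightarrow> v \<in> X"
      unfolding separating_family_def by blast
    define S where "S = {Z \<in> F. (u \<in> Z) \<noteq> (v \<in> Z)}"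
    define cr where "cr Z = {W \<in> N. crossing V Z W}" for Z
    have "\<exists>Z. Z \<in> S"
      using sep uv unfolding S_def separating_family_def by blast
    then obtain Z where Z: "Z \<in> S" and least: "\<And>Z'. Z' \<in> S \<Longrightarrow> card (cr Z) \<le> card (cr Z')"
      using ex_has_least_nat[of "\<lambda>Z. Z \<in> S" _ "\<lambda>Z. card (cr Z)"] by metis
    \<comment> \<open>Otherwise \<open>Z\<close> could be added to \<open>N\<close>, against
      maximality.\<close>
    have "cr Z \<noteq> {}"
    proof
      assume "cr Z = {}"
      then have Z1: "\<not> crossing V Z W" if "W \<in> N" for W
        using that by (auto simp: cr_def)
      then have Z2: "\<not> crossing V W Z" if "W \<in> N" for W
        using that by (subst crossing_sym)
      have "\<not> crossing V Z Z"
        by (simp add: crossing_def)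
      then have "nested_family V (insert Z N)"
        using Z1 Z2 N(2) unfolding nested_family_def by simp
      moreover have "insert Z N \<subseteq> F"
        using N(1) Z S_def by auto
      ultimately have "insert Z N = N"
        using maxN by blast
      then show False
        using Z same unfolding S_def by blast
    qed
    then obtain M where M: "M \<in> N" "crossing V Z M"
      unfolding cr_def by blast
    have sub: "Z \<subseteq> V" "\<And>W. W \<in> N \<Longrightarrow> W \<subseteq> V"
      using F Z N(1) S_def by auto
    have nestM: "\<not> crossing V M W" if "W \<in> N" for W
      using N(2) M(1) that by (simp add: nested_family_def)
    have clo: "Z \<inter> M \<in> F" "Z \<union> M \<in> F"
      using closed M N(1) Z S_def by auto
    \<comment> \<open>\<open>M\<close> has \<open>u\<close> and \<open>v\<close> on the same side.
      If both lie in \<open>M\<close>, then \<open>Z \<inter> M\<close> still separates them; if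
      neither does, \<open>Z \<union> M\<close> does. The corner no longer crosses \<open>M\<close>
      and crosses nothing new.\<close>
    have "\<exists>Z' \<in> S. cr Z' \<subset> cr Z"
    proof (cases "u \<in> M")
      case True
      then have "v \<in> M"
        using same M(1) by blast
      then have "Z \<inter> M \<in> S"
        using clo True Z unfolding S_def by auto
      moreover have "cr (Z \<inter> M) \<subseteq> cr Z"
        using crossing_InterD[OF sub(1) sub(2)[OF M(1)] sub(2) M(2) nestM] by (auto simp: cr_def)
      moreover have "M \<in> cr Z - cr (Z \<inter> M)"
        using M by (simp add: cr_def not_crossing_corner)
      ultimately show ?thesis
        by blast
    next
      case False
      then have "v \<notin> M"
        using same M(1) by blast
      then have "Z \<union> M \<in> S"
        using clo False Z unfolding S_def by auto
      moreover have "cr (Z \<union> M) \<subseteq> cr Z"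
        using crossing_UnionD[OF sub(1) sub(2)[OF M(1)] sub(2) M(2) nestM] by (auto simp: cr_def)
      moreover have "M \<in> cr Z - cr (Z \<union> M)"
        using M by (simp add: cr_def not_crossing_corner)
      ultimately show ?thesis
        by blast
    qed
    moreover have "finite (cr Z)"
      using finN by (simp add: cr_def)
    ultimately show False
      using least by (meson not_le psubset_card_mono)
  qed
  then show ?thesis
    using N by blast
qed

text \<open>In a separating subfamily \<open>M\<close> of least size, each \<open>X\<close> has
  points \<open>a X\<close> and \<open>b X\<close> that no other member separates; they form the
  edge of \<open>X\<close>. The map \<open>c\<close> sends an edge back to its set, whose cut
  consists of that edge alone.\<close>

lemma nested_separating_tree:
  assumes fin: "finite N" and N: "nested_family V N" "separating_family V N"
  obtains E c where "\<forall>e \<in> E. e \<subseteq> V \<and> card e = 2"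
    and "\<forall>u \<in> V. \<forall>v \<in> V. (u, v) \<in> {(u, v). {u, v} \<in> E}\<^sup>*"
    and "\<forall>e \<in> E. c e \<in> N"
    and "\<forall>e \<in> E. \<forall>u v. {u, v} \<in> E \<longrightarrow> ((u \<in> c e) \<noteq> (v \<in> c e)) = ({u, v} = e)"
proof -
  obtain M where M: "M \<subseteq> N" "separating_family V M"
    and minM: "\<And>M'. M' \<subseteq> N \<Longrightarrow> separating_family V M' \<Longrightarrow> card M \<le> card M'"
    using ex_has_least_nat[of "\<lambda>M. M \<subseteq> N \<and> separating_family V M" N card] N(2)
    by (metis (no_types, lifting) subset_refl)
  have finM: "finite M"
    using M(1) fin finite_subset by blast
  have nest: "\<not> crossing V X Y" if "X \<in> M" "Y \<in> M" for X Y
    using that N(1) M(1) by (auto simp: nested_family_def)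
  have "\<exists>a b. a \<in> V \<and> b \<in> V \<and> a \<in> X \<and> b \<notin> X \<and> (\<forall>Y \<in> M. Y \<noteq> X \<longrightarrow> a \<in> Y \<longleftrightarrow> b \<in> Y)"
    if X: "X \<in> M" for X
  proof -
    have "card (M - {X}) < card M"
      by (rule card_Diff1_less[OF finM X])
    then have "\<not> separating_family V (M - {X})"
      using minM[of "M - {X}"] M(1) by (meson Diff_subset leD subset_trans)
    then obtain a b where ab: "a \<in> V" "b \<in> V" "a \<noteq> b" "\<forall>Y \<in> M - {X}. a \<in> Y \<longleftrightarrow> b \<in> Y"
      unfolding separating_family_def by blast
    with M(2) have "(a \<in> X) \<noteq> (b \<in> X)"
      unfolding separating_family_def by blast
    then show ?thesis
      using ab by (cases "a \<in> X") blast+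
  qed
  then obtain a b where ab: "\<And>X. X \<in> M \<Longrightarrow> a X \<in> V \<and> b X \<in> V \<and> a X \<in> X \<and> b X \<notin> X"
    and same: "\<And>X Y. X \<in> M \<Longrightarrow> Y \<in> M \<Longrightarrow> Y \<noteq> X \<Longrightarrow> a X \<in> Y \<longleftrightarrow> b X \<in> Y"
    by metis
  define edge where "edge X = {a X, b X}" for X
  define E where "E = edge ` M"
  define R where "R = {(u, v). {u, v} \<in> E}"
  \<comment> \<open>If \<open>X\<close> and \<open>Y\<close> had the same edge, then
    \<open>X\<close> would separate \<open>a Y\<close> from \<open>b Y\<close>, which only
    \<open>Y\<close> does.\<close>
  have inj: "inj_on edge M"
  proof (rule inj_onI)
    fix X Y assume XY: "X \<in> M" "Y \<in> M" "edge X = edge Y"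
    then have "a X = a Y \<and> b X = b Y \<or> a X = b Y \<and> b X = a Y"
      unfolding edge_def by (simp add: doubleton_eq_iff)
    then show "X = Y"
      using ab[OF XY(1)] same[OF XY(2,1)] by metis
  qed
  have symR: "(v, u) \<in> R\<^sup>*" if "(u, v) \<in> R\<^sup>*" for u v
  proof -
    have "sym R"
      unfolding R_def sym_def by (simp add: insert_commute)
    then show ?thesis
      using that by (meson sym_rtrancl symD)
  qed
  \<comment> \<open>Induction on the number of members of \<open>M\<close> that separate
    \<open>u\<close> from \<open>v\<close>.\<close>
  have conn: "(u, v) \<in> R\<^sup>*" if "u \<in> V" "v \<in> V" for u v
    using that
  proof (induction "card {X \<in> M. (u \<in> X) \<noteq> (v \<in> X)}" arbitrary: u v rule: less_induct)
    case less
    show ?case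
    proof (cases "u = v")
      case False
      \<comment> \<open>Route from \<open>u\<close> to \<open>a X\<close>, along the edge of
        \<open>X\<close>, then from \<open>b X\<close> to \<open>v\<close>. Both outer pairs are
        separated by fewer members, as \<open>X\<close> drops out. \<open>IH\<close> is a premise so
        that the argument also serves with \<open>u\<close> and \<open>v\<close> exchanged.\<close>
      have step: "(u, v) \<in> R\<^sup>*"
        if u: "u \<in> V" and v: "v \<in> V" and X: "X \<in> M" "u \<in> X" "v \<notin> X"
          and IH: "\<And>u' v'. card {X \<in> M. (u' \<in> X) \<noteq> (v' \<in> X)} < card {X \<in> M. (u \<in> X) \<noteq> (v \<in> X)} \<Longrightarrow>
             u' \<in> V \<Longrightarrow> v' \<in> V \<Longrightarrow> (u', v') \<in> R\<^sup>*" for u v X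
      proof -
        \<comment> \<open>Some \<open>Y \<noteq> X\<close> with \<open>u, v\<close> on one side and the ends of the edge of \<open>X\<close> on the other
          would cross \<open>X\<close>.\<close>
        have *: "(u \<in> Y) \<noteq> (v \<in> Y)"
          if Y: "Y \<in> M" "Y \<noteq> X" "(u \<in> Y) \<noteq> (a X \<in> Y) \<or> (b X \<in> Y) \<noteq> (v \<in> Y)" for Y
          using nest[OF X(1) Y(1)] ab[OF X(1)] same[OF X(1) Y(1,2)] Y(3) X(2,3) u v
          unfolding crossing_def by blast
        have "{Y \<in> M. (u \<in> Y) \<noteq> (a X \<in> Y)} \<subseteq> {Y \<in> M. (u \<in> Y) \<noteq> (v \<in> Y)} - {X}"
          using * ab[OF X(1)] X(2) by blast
        then have "{Y \<in> M. (u \<in> Y) \<noteq> (a X \<in> Y)} \<subset> {Y \<in> M. (u \<in> Y) \<noteq> (v \<in> Y)}"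
          using X by blast
        then have "(u, a X) \<in> R\<^sup>*"
          using IH ab[OF X(1)] u finM by (simp add: psubset_card_mono)
        moreover have "{Y \<in> M. (b X \<in> Y) \<noteq> (v \<in> Y)} \<subseteq> {Y \<in> M. (u \<in> Y) \<noteq> (v \<in> Y)} - {X}"
          using * ab[OF X(1)] X(3) by blast
        then have "{Y \<in> M. (b X \<in> Y) \<noteq> (v \<in> Y)} \<subset> {Y \<in> M. (u \<in> Y) \<noteq> (v \<in> Y)}"
          using X by blast
        then have "(b X, v) \<in> R\<^sup>*"
          using IH ab[OF X(1)] v finM by (simp add: psubset_card_mono)
        moreover have "(a X, b X) \<in> R"
          using X(1) unfolding R_def E_def edge_def by blast
        ultimately show ?thesis
          by (meson converse_rtrancl_into_rtrancl rtrancl_trans)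
      qed
      obtain X where X: "X \<in> M" "(u \<in> X) \<noteq> (v \<in> X)"
        using M(2) less.prems False unfolding separating_family_def by blast
      show ?thesis
      proof (cases "u \<in> X")
        case True
        then show ?thesis
          using X less by (intro step[of u v X]) auto
      next
        case False
        have eq: "{X \<in> M. (v \<in> X) \<noteq> (u \<in> X)} = {X \<in> M. (u \<in> X) \<noteq> (v \<in> X)}"
          by blast
        have "(v, u) \<in> R\<^sup>*"
          using X less False by (intro step[of v u X]) (auto simp only: eq)
        then show ?thesis
          by (rule symR)
      qed
    qed simp
  qed
  have cut: "((u \<in> X) \<noteq> (v \<in> X)) = ({u, v} = edge X)" if X: "X \<in> M" and uv: "{u, v} \<in> E" for X u v
  proof -
    obtain Y where Y: "Y \<in> M" "{u, v} = edge Y"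
      using uv E_def by blast
    then have "u = a Y \<and> v = b Y \<or> u = b Y \<and> v = a Y"
      unfolding edge_def by (simp add: doubleton_eq_iff)
    moreover have "X = Y \<longleftrightarrow> edge X = edge Y"
      using inj Y(1) X by (auto dest: inj_onD)
    ultimately show ?thesis
      using Y X same[OF Y(1) X] ab[OF Y(1)] by metis
  qed
  have "\<forall>e \<in> E. e \<subseteq> V \<and> card e = 2"
    unfolding E_def edge_def using ab by (auto simp: card_2_iff) (metis ab)
  moreover have "\<forall>e \<in> E. inv_into M edge e \<in> N"
    using M(1) unfolding E_def by (auto simp: inv_into_into inj)
  moreover have "((u \<in> inv_into M edge e) \<noteq> (v \<in> inv_into M edge e)) = ({u, v} = e)"
    if e: "e \<in> E" "{u, v} \<in> E" for e u v
  proof -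
    have "inv_into M edge e \<in> M" "edge (inv_into M edge e) = e"
      using e(1) unfolding E_def by (simp_all add: inv_into_into f_inv_into_f)
    then show ?thesis
      using cut[of "inv_into M edge e" u v] e(2) by simp
  qed
  moreover have "\<forall>u \<in> V. \<forall>v \<in> V. (u, v) \<in> {(u, v). {u, v} \<in> E}\<^sup>*"
    using conn by (simp add: R_def)
  ultimately show thesis
    by (intro that[of E "inv_into M edge"]) simp_all
qed

section \<open>Paths and cuts\<close>

lemma walk_edges_simps [simp]:
  fixes x y :: 'v
  shows "walk_edges ([] :: 'v list) = {}" "walk_edges [x] = {}"
  "walk_edges (x # y # p) = insert {x, y} (walk_edges (y # p))"
proof -
  have *: "walk_edges q = (\<lambda>i. {q ! i, q ! Suc i}) ` {i. Suc i < length q}" for q :: "'v list"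
    unfolding walk_edges_def by blast
  have "{i. Suc i < length (x # y # p)} = insert 0 (Suc ` {i. Suc i < length (y # p)})"
    by (auto simp: less_Suc_eq_0_disj)
  then show "walk_edges (x # y # p) = insert {x, y} (walk_edges (y # p))"
    by (simp only: * image_insert image_image nth_Cons_0 nth_Cons_Suc)
qed (auto simp: walk_edges_def)

lemma walk_edges_append:
  assumes "p \<noteq> []" "q \<noteq> []"
  shows "walk_edges (p @ q) = walk_edges p \<union> {{last p, hd q}} \<union> walk_edges q"
  using assms
proof (induction p)
  case (Cons x p)
  then show ?case
    by (cases p; cases q) auto
qed simp

lemma walk_edges_subset_set: "e \<in> walk_edges p \<Longrightarrow> e \<subseteq> set p"
  unfolding walk_edges_def by auto

text \<open>Extend a path edge by edge; if the next vertex is already on it, truncate the path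
  there.\<close>

lemma upath_if_rtrancl:
  assumes "(u, v) \<in> {(u, v). {u, v} \<in> E}\<^sup>*" "u \<in> V" "\<forall>e \<in> E. e \<subseteq> V"
  shows "\<exists>p. upath V E u p v"
  using assms(1)
proof (induction rule: rtrancl_induct)
  case base
  have "upath V E u [u] u"
    using assms(2) by (simp add: upath_def)
  then show ?case
    by blast
next
  case (step v w)
  then obtain p where p: "upath V E u p v" and vw: "{v, w} \<in> E"
    by blast
  show ?case
  proof (cases "w \<in> set p")
    case True
    then obtain q r where qr: "p = q @ w # r"
      by (meson split_list)
    have "walk_edges (q @ [w]) \<subseteq> walk_edges p"
      using walk_edges_append[of "q @ [w]" r] qr by (cases "r = []") auto
    then have "upath V E u (q @ [w]) w"
      using p qr unfolding upath_def by (cases q) auto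
    then show ?thesis
      by blast
  next
    case False
    have "w \<in> V"
      using assms(3) vw by blast
    then have "upath V E u (p @ [w]) w"
      using p False vw unfolding upath_def by (auto simp: walk_edges_append)
    then show ?thesis
      by blast
  qed
qed

text \<open>Only \<open>e\<close> switches sides of \<open>X\<close>, and a path without repeated
  vertices uses it at most once.\<close>

lemma path_crosses_cut_iff:
  assumes "p \<noteq> []" "distinct p"
    and "\<And>u v. {u, v} \<in> walk_edges p \<Longrightarrow> ((u \<in> X) \<noteq> (v \<in> X)) = ({u, v} = e)"
  shows "((hd p \<in> X) \<noteq> (last p \<in> X)) = (e \<in> walk_edges p)"
  using assms
proof (induction p)
  case (Cons x p)
  show ?case
  proof (cases p)
    case (Cons y q)
    have "((y \<in> X) \<noteq> (last p \<in> X)) = (e \<in> walk_edges p)"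
      using Cons.IH Cons.prems Cons by auto
    moreover have "((x \<in> X) \<noteq> (y \<in> X)) = ({x, y} = e)"
      using Cons.prems(3) Cons by simp
    moreover have "{x, y} \<notin> walk_edges p"
      using walk_edges_subset_set[of "{x, y}" p] Cons.prems(2) by auto
    ultimately show ?thesis
      using Cons by auto
  qed simp
qed simp

text \<open>A cycle is impossible: its closing edge \<open>e\<close> has ends on different sides of
  \<open>c e\<close>, but the rest of the cycle joins these ends without using
  \<open>e\<close>.\<close>

lemma utree_if_cuts:
  assumes fin: "finite V" and E: "\<forall>e \<in> E. e \<subseteq> V \<and> card e = 2"
    and conn: "\<forall>u \<in> V. \<forall>v \<in> V. (u, v) \<in> {(u, v). {u, v} \<in> E}\<^sup>*"
    and cut: "\<And>e u v. e \<in> E \<Longrightarrow> {u, v} \<in> E \<Longrightarrow> ((u \<in> c e) \<noteq> (v \<in> c e)) = ({u, v} = e)"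
  shows "utree V E"
proof -
  have "\<exists>p. upath V E u p v" if "u \<in> V" "v \<in> V" for u v
    using upath_if_rtrancl conn that E by metis
  moreover have "\<not> ucycle V E p" for p
  proof
    assume p: "ucycle V E p"
    let ?e = "{last p, hd p}"
    have e: "?e \<in> E" and we: "walk_edges p \<subseteq> E" and dist: "distinct p" and len: "length p \<ge> 3"
      using p by (auto simp: ucycle_def)
    have "((hd p \<in> c ?e) \<noteq> (last p \<in> c ?e)) = (?e \<in> walk_edges p)"
      using len dist cut[OF e] we by (intro path_crosses_cut_iff) auto
    moreover have "((hd p \<in> c ?e) \<noteq> (last p \<in> c ?e)) = ({hd p, last p} = ?e)"
      using cut[OF e, of "hd p" "last p"] e by (simp add: insert_commute)
    \<comment> \<open>Length at least 3 matters here: \<open>x\<close> lies on the first edge of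
      \<open>p\<close> only, and the other end \<open>y\<close> of that edge is not the last
      vertex.\<close>
    moreover have "?e \<notin> walk_edges p"
    proof -
      obtain x y z q where q: "p = x # y # z # q"
        using len by (metis One_nat_def Suc_le_length_iff numeral_3_eq_3)
      then have "x \<notin> set (y # z # q)" "last p \<in> set (z # q)" "y \<notin> set (z # q)"
        using dist by auto
      then show ?thesis
        using q walk_edges_subset_set[of "{last p, x}" "y # z # q"]
        by (auto simp: doubleton_eq_iff)
    qed
    ultimately show False
      by auto
  qed
  ultimately show ?thesis
    using fin E unfolding utree_def usimple_graph_def by blast
qed

section \<open>Separations and tangles\<close>

definition one_way :: "('a, 'b) pre_digraph \<Rightarrow> 'a set \<Rightarrow> 'a set \<Rightarrow> bool" where
  "one_way G X Y \<longleftrightarrow> (\<forall>e \<in> arcs G. \<not> (tail G e \<in> X - Y \<and> head G e \<in> Y - X))"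

text \<open>Membership in a tangle depends only on vertex sets, so new separations can be built from
  subgraphs without arcs.\<close>

definition edgeless :: "('a, 'b) pre_digraph \<Rightarrow> 'a set \<Rightarrow> ('a, 'b) pre_digraph" where
  "edgeless G X = G\<lparr>verts := X, arcs := {}\<rparr>"

lemma verts_edgeless [simp]: "verts (edgeless G X) = X"
  by (simp add: edgeless_def)

lemma mem_dseps_iff:
  "(A, B) \<in> dseps G \<longleftrightarrow> subgraph A G \<and> subgraph B G \<and> verts A \<union> verts B = verts G \<and>
     (one_way G (verts A) (verts B) \<or> one_way G (verts B) (verts A))"
  unfolding dseps_def one_way_def by auto

lemma subgraph_edgeless:
  assumes "wf_digraph G" "X \<subseteq> verts G"
  shows "subgraph (edgeless G X) G"
  using assms unfolding edgeless_def
  by (intro Digraph_Component.subgraphI) (auto simp: wf_digraph_def compatible_def)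

lemma edgeless_mem_dseps:
  assumes "wf_digraph G" "X \<union> Y = verts G" "one_way G X Y \<or> one_way G Y X"
  shows "(edgeless G X, edgeless G Y) \<in> dseps G"
  unfolding mem_dseps_iff using assms by (auto intro: subgraph_edgeless)

lemma dseps_swap: "(A, B) \<in> dseps G \<longleftrightarrow> (B, A) \<in> dseps G"
  unfolding mem_dseps_iff by blast

lemma sep_order_swap: "sep_order (B, A) = sep_order (A, B)"
  by (simp add: sep_order_def Int_commute)

text \<open>A subgraph is determined by its vertices and arcs, since \<open>tail\<close> and
  \<open>head\<close> are those of \<open>G\<close>. This makes the set of tangles finite.\<close>

lemma finite_dseps:
  assumes "fin_digraph G"
  shows "finite (dseps G)"
proof -
  interpret fin_digraph G by fact
  let ?f = "\<lambda>(X, Y). \<lparr>verts = X, arcs = Y, tail = tail G, head = head G\<rparr>"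
  have "A \<in> ?f ` (Pow (verts G) \<times> Pow (arcs G))" if "subgraph A G" for A
  proof
    show "A = ?f (verts A, arcs A)"
      using that by (auto simp: subgraph_def compatible_def intro: pre_digraph.equality)
  qed (use that in \<open>auto simp: subgraph_def\<close>)
  then have "{A. subgraph A G} \<subseteq> ?f ` (Pow (verts G) \<times> Pow (arcs G))"
    by blast
  then have "finite {A. subgraph A G}"
    by (rule finite_subset) simp
  moreover have "dseps G \<subseteq> {A. subgraph A G} \<times> {A. subgraph A G}"
    by (auto simp: dseps_def)
  ultimately show ?thesis
    by (meson finite_SigmaI finite_subset)
qed

section \<open>Membership in tangles\<close>

lemma tangle_subset_dseps: "is_tangle G k T \<Longrightarrow> T \<subseteq> dseps G"
  unfolding is_tangle_def by blast

text \<open>Otherwise \<open>(B, A)\<close> is in \<open>T\<close>, and \<open>B\<close>,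
  \<open>C\<close>, \<open>C'\<close> are three first sides that cover \<open>G\<close>.\<close>

lemma tangle_memI:
  assumes "is_tangle G k T" "(A, B) \<in> dseps G" "sep_order (A, B) < k"
    and "(C, D) \<in> T" "(C', D') \<in> T" "verts B \<union> verts C \<union> verts C' = verts G"
  shows "(A, B) \<in> T"
  using assms unfolding is_tangle_def by blast

lemma tangle_not_both:
  assumes "is_tangle G k T" "(A, B) \<in> T"
  shows "(B, A) \<notin> T"
proof
  assume "(B, A) \<in> T"
  moreover have "(A, B) \<in> dseps G"
    using tangle_subset_dseps assms by blast
  then have "verts A \<union> verts B \<union> verts B = verts G"
    by (auto simp: mem_dseps_iff)
  ultimately show False
    using assms unfolding is_tangle_def by blast
qed

lemma tangle_swap_mem_iff:
  assumes "is_tangle G k T" "(A, B) \<in> dseps G" "sep_order (A, B) < k"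
  shows "(B, A) \<in> T \<longleftrightarrow> (A, B) \<notin> T"
  using assms tangle_not_both unfolding is_tangle_def by blast

section \<open>Distinguishers and their possible orders\<close>

lemma distinguishes_iff:
  assumes "is_tangle G k T" "is_tangle G k' T'" "(A, B) \<in> dseps G"
    and "sep_order (A, B) < k" "sep_order (A, B) < k'"
  shows "distinguishes (A, B) T T' \<longleftrightarrow> ((A, B) \<in> T) \<noteq> ((A, B) \<in> T')"
  using tangle_swap_mem_iff[OF assms(1,3,4)] tangle_swap_mem_iff[OF assms(2,3,5)]
  unfolding distinguishes_def by auto

text \<open>Put a vertex outside \<open>A \<inter> B\<close> into both sides. The order grows by
  one, and each of the two tangles keeps its orientation.\<close>

lemma distinguishes_enlarge:
  assumes G: "fin_digraph G" and T: "is_tangle G k T" "is_tangle G k' T'"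
    and AB: "(A, B) \<in> dseps G" "distinguishes (A, B) T T'"
    and ord: "Suc (sep_order (A, B)) < k" "Suc (sep_order (A, B)) < k'" "sep_order (A, B) < card (verts G)"
  shows "\<exists>S \<in> dseps G. sep_order S = Suc (sep_order (A, B)) \<and> distinguishes S T T'"
proof -
  interpret fin_digraph G by fact
  have sub: "verts A \<union> verts B = verts G"
    using AB by (simp add: mem_dseps_iff)
  have "verts A \<inter> verts B \<noteq> verts G"
    using ord(3) by (auto simp: sep_order_def)
  then obtain v where v: "v \<in> verts G" "v \<notin> verts A \<inter> verts B"
    using sub by blast
  let ?A = "edgeless G (insert v (verts A))" and ?B = "edgeless G (insert v (verts B))"
  have S: "(?A, ?B) \<in> dseps G"
  proof (rule edgeless_mem_dseps)
    show "one_way G (insert v (verts A)) (insert v (verts B)) \<or>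
        one_way G (insert v (verts B)) (insert v (verts A))"
      using AB(1) unfolding mem_dseps_iff one_way_def by blast
  qed (use sub v wf_digraph_axioms in auto)
  have Int_insert: "insert v (verts A) \<inter> insert v (verts B) = insert v (verts A \<inter> verts B)"
    by blast
  have "finite (verts A \<inter> verts B)"
    using sub finite_verts by (metis finite_Int finite_Un)
  then have o: "sep_order (?A, ?B) = Suc (sep_order (A, B))"
    using v by (simp add: sep_order_def Int_insert)
  have mem: "(?A, ?B) \<in> T \<longleftrightarrow> (A, B) \<in> T"
    if T: "is_tangle G k T" and k: "Suc (sep_order (A, B)) < k" for T k
  proof -
    have B: "(B, A) \<in> T \<longleftrightarrow> (A, B) \<notin> T"
      using tangle_swap_mem_iff[OF T AB(1)] k by simp
    have B': "(?B, ?A) \<in> T \<longleftrightarrow> (?A, ?B) \<notin> T"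
      using tangle_swap_mem_iff[OF T S] k o by simp
    \<comment> \<open>The second side \<open>?B\<close> together with \<open>A\<close> already
      covers \<open>G\<close>.\<close>
    have "(A, B) \<in> T \<Longrightarrow> (?A, ?B) \<in> T"
      using tangle_memI[OF T S, of A B A B] k o sub v by auto
    moreover have "(B, A) \<in> T \<Longrightarrow> (?B, ?A) \<in> T"
      using tangle_memI[OF T S[unfolded dseps_swap[of ?A]], of B A B A] k o sub v
      by (auto simp: sep_order_swap)
    ultimately show ?thesis
      using B B' by blast
  qed
  have "distinguishes (?A, ?B) T T'"
    using mem[OF T(1) ord(1)] mem[OF T(2) ord(2)] AB(2)
      distinguishes_iff[OF T AB(1)] distinguishes_iff[OF T S] ord o by simp
  then show ?thesis
    using S o by blast
qed

text \<open>Enlarge repeatedly. The bound by the number of vertices guarantees that a vertex outside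
  the separator is left at every step.\<close>

lemma distinguishes_of_order:
  assumes G: "fin_digraph G" and T: "is_tangle G k T" "is_tangle G k' T'"
    and S: "S \<in> dseps G" "distinguishes S T T'"
    and m: "sep_order S \<le> m" "m < k" "m < k'" "m \<le> card (verts G)"
  shows "\<exists>S \<in> dseps G. sep_order S = m \<and> distinguishes S T T'"
  using m
proof (induction m rule: dec_induct)
  case base
  then show ?case
    using S by blast
next
  case (step n)
  then obtain A B where "(A, B) \<in> dseps G" "sep_order (A, B) = n" "distinguishes (A, B) T T'"
    by fastforce
  then show ?case
    using distinguishes_enlarge[OF G T, of A B] step.prems by auto
qed

lemma sep_order_le_card:
  assumes "fin_digraph G" "S \<in> dseps G"
  shows "sep_order S \<le> card (verts G)"
proof -
  have "verts (fst S) \<inter> verts (snd S) \<subseteq> verts G"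
    using assms(2) by (auto simp: dseps_def)
  then show ?thesis
    using assms(1) unfolding sep_order_def fin_digraph_def fin_digraph_axioms_def
    by (simp add: card_mono)
qed

section \<open>Corners of two oriented separations\<close>

text \<open>The other two corners \<open>(A \<inter> D, B \<union> C)\<close> and \<open>(A \<union> D, B \<inter> C)\<close> need not be directed separations.\<close>

locale corner_pair =
  fixes G :: "('a, 'b) pre_digraph" and A B C D :: "('a, 'b) pre_digraph"
  assumes G: "fin_digraph G"
    and AB: "(A, B) \<in> dseps G" "one_way G (verts A) (verts B)"
    and CD: "(C, D) \<in> dseps G" "one_way G (verts C) (verts D)"
begin

abbreviation "PA \<equiv> edgeless G (verts A \<union> verts C)"
abbreviation "PB \<equiv> edgeless G (verts B \<inter> verts D)"
abbreviation "QA \<equiv> edgeless G (verts A \<inter> verts C)"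
abbreviation "QB \<equiv> edgeless G (verts B \<union> verts D)"

lemma cover: "verts A \<union> verts B = verts G" "verts C \<union> verts D = verts G"
  using AB CD by (auto simp: mem_dseps_iff)

text \<open>By \<open>cover\<close>, a forbidden edge for a corner would be forbidden for
  \<open>(A, B)\<close> or for \<open>(C, D)\<close>.\<close>

lemma one_way_corners:
  "one_way G (verts PA) (verts PB)" "one_way G (verts QA) (verts QB)"
proof -
  have wf: "tail G e \<in> verts G" "head G e \<in> verts G" if "e \<in> arcs G" for e
    using G that by (auto simp: fin_digraph_def wf_digraph_def)
  then show "one_way G (verts PA) (verts PB)"
    using AB(2) CD(2) cover unfolding one_way_def by simp blast
  show "one_way G (verts QA) (verts QB)"
    using wf AB(2) CD(2) cover unfolding one_way_def by simp blast
qed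

lemma corners_mem_dseps: "(PA, PB) \<in> dseps G" "(QA, QB) \<in> dseps G"
  using cover one_way_corners G
  by (auto intro!: edgeless_mem_dseps simp: fin_digraph_def)

text \<open>Submodularity: a vertex in either corner separator lies in one of the original
  separators, and a vertex in both lies in both.\<close>

lemma corner_orders:
  "sep_order (PA, PB) + sep_order (QA, QB) \<le> sep_order (A, B) + sep_order (C, D)"
proof -
  let ?P = "(verts A \<union> verts C) \<inter> (verts B \<inter> verts D)"
  let ?Q = "(verts A \<inter> verts C) \<inter> (verts B \<union> verts D)"
  have fin: "finite (verts A)" "finite (verts C)" "finite (verts B)" "finite (verts D)"
    using cover G
    by (metis finite_Un fin_digraph.finite_verts)+
  have "card ?P + card ?Q = card (?P \<union> ?Q) + card (?P \<inter> ?Q)"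
    using fin by (intro card_Un_Int) auto
  also have "\<dots> \<le> card ((verts A \<inter> verts B) \<union> (verts C \<inter> verts D)) +
      card ((verts A \<inter> verts B) \<inter> (verts C \<inter> verts D))"
    using fin by (intro add_mono card_mono) auto
  also have "\<dots> = card (verts A \<inter> verts B) + card (verts C \<inter> verts D)"
    using fin by (intro card_Un_Int[symmetric]) auto
  finally show ?thesis
    by (simp add: sep_order_def)
qed

text \<open>Lets the corners realise intersection and union of sets of tangles. Each membership
  comes from a cover of \<open>G\<close>; for instance \<open>A\<close>, \<open>C\<close> and
  \<open>B \<inter> D\<close> cover it.\<close>

lemma corners_mem_tangle_iff:
  assumes T: "is_tangle G k T" and ord: "sep_order (A, B) < k" "sep_order (C, D) < k"
  shows "sep_order (PA, PB) < k \<Longrightarrow> (PA, PB) \<in> T \<longleftrightarrow> (A, B) \<in> T \<and> (C, D) \<in> T"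
    and "sep_order (QA, QB) < k \<Longrightarrow> (QA, QB) \<in> T \<longleftrightarrow> (A, B) \<in> T \<or> (C, D) \<in> T"
proof -
  note sw = tangle_swap_mem_iff[OF T AB(1) ord(1)] tangle_swap_mem_iff[OF T CD(1) ord(2)]
  have swapped: "(PB, PA) \<in> dseps G" "(QB, QA) \<in> dseps G"
    using corners_mem_dseps dseps_swap by blast+
  show "(PA, PB) \<in> T \<longleftrightarrow> (A, B) \<in> T \<and> (C, D) \<in> T" if o: "sep_order (PA, PB) < k"
  proof -
    have o': "sep_order (PB, PA) < k"
      using o by (simp only: sep_order_swap)
    have "(PA, PB) \<in> T" if "(A, B) \<in> T" "(C, D) \<in> T"
      using tangle_memI[OF T corners_mem_dseps(1) o that] cover by auto
    moreover have "(PB, PA) \<in> T" if "(B, A) \<in> T"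
      using tangle_memI[OF T swapped(1) o' that that] cover by auto
    moreover have "(PB, PA) \<in> T" if "(D, C) \<in> T"
      using tangle_memI[OF T swapped(1) o' that that] cover by auto
    ultimately show ?thesis
      using sw tangle_not_both[OF T] by blast
  qed
  show "(QA, QB) \<in> T \<longleftrightarrow> (A, B) \<in> T \<or> (C, D) \<in> T" if o: "sep_order (QA, QB) < k"
  proof -
    have o': "sep_order (QB, QA) < k"
      using o by (simp only: sep_order_swap)
    have "(QB, QA) \<in> T" if "(B, A) \<in> T" "(D, C) \<in> T"
      using tangle_memI[OF T swapped(2) o' that] cover by auto
    moreover have "(QA, QB) \<in> T" if "(A, B) \<in> T"
      using tangle_memI[OF T corners_mem_dseps(2) o that that] cover by auto
    moreover have "(QA, QB) \<in> T" if "(C, D) \<in> T"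
      using tangle_memI[OF T corners_mem_dseps(2) o that that] cover by auto
    ultimately show ?thesis
      using sw tangle_not_both[OF T] by blast
  qed
qed

end

theorem theorem6p3:
  fixes G :: "('a, 'b) pre_digraph" and l :: nat and TT :: "('a, 'b) dsep set set"
  assumes "fin_digraph G"
    and "\<And>T. T \<in> TT \<Longrightarrow> \<exists>k > l. is_tangle G k T"
    and "\<And>T T'. T \<in> TT \<Longrightarrow> T' \<in> TT \<Longrightarrow> T \<noteq> T' \<Longrightarrow>
           distinguishable G (int l) T T' \<and> \<not> distinguishable G (int l - 1) T T'"
  shows "\<exists>(V :: nat set) E \<beta> \<gamma>.
           tree_labelling G TT V E \<beta> \<gamma> \<and> (\<forall>e \<in> E. sep_order (\<gamma> e) = l)"
proof -
  obtain k where k: "\<And>T. T \<in> TT \<Longrightarrow> l < k T" "\<And>T. T \<in> TT \<Longrightarrow> is_tangle G (k T) T"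
    using assms(2) by metis
  have "TT \<subseteq> Pow (dseps G)"
    using tangle_subset_dseps k(2) by blast
  then have "finite TT"
    using finite_dseps[OF assms(1)] by (simp add: finite_subset)
  then obtain \<beta> where \<beta>: "bij_betw \<beta> {..<card TT} TT"
    using ex_bij_betw_nat_finite[of TT] by (auto simp: atLeast0LessThan)
  define V where "V = {..<card TT}"
  have \<beta>V: "\<beta> v \<in> TT" if "v \<in> V" for v
    using \<beta> that unfolding V_def by (rule bij_betw_apply)
  have \<beta>inj: "\<beta> u \<noteq> \<beta> v" if "u \<in> V" "v \<in> V" "u \<noteq> v" for u v
    using \<beta> that unfolding V_def bij_betw_def by (auto dest: inj_onD)
  \<comment> \<open>The hypothesis excludes order exactly \<open>l - 1\<close>. A distinguisher of
    smaller order could be enlarged to that order, as \<open>l\<close> is at most the number of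
    vertices.\<close>
  have min_order: "l \<le> sep_order S"
    if T: "T \<in> TT" "T' \<in> TT" "T \<noteq> T'" and S: "S \<in> dseps G" "distinguishes S T T'" for S T T'
  proof (rule ccontr)
    assume "\<not> l \<le> sep_order S"
    moreover have "l \<le> card (verts G)"
      using assms(3)[OF T] sep_order_le_card[OF assms(1)] unfolding distinguishable_def by fastforce
    ultimately have "\<exists>S \<in> dseps G. sep_order S = l - 1 \<and> distinguishes S T T'"
      using k(1)[OF T(1)] k(1)[OF T(2)]
      by (intro distinguishes_of_order[OF assms(1) k(2)[OF T(1)] k(2)[OF T(2)] S]) linarith+
    \<comment> \<open>The natural subtraction is not truncated: an order below \<open>l\<close>
      forces \<open>l\<close> to be positive.\<close>
    moreover have "int (l - 1) = int l - 1"
      using \<open>\<not> l \<le> sep_order S\<close> by linarith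
    ultimately have "distinguishable G (int l - 1) T T'"
      unfolding distinguishable_def by metis
    then show False
      using assms(3)[OF T] by blast
  qed
  have dist_iff: "distinguishes S (\<beta> u) (\<beta> v) \<longleftrightarrow> (S \<in> \<beta> u) \<noteq> (S \<in> \<beta> v)"
    if "u \<in> V" "v \<in> V" "S \<in> dseps G" "sep_order S \<le> l" for u v S
    using distinguishes_iff[OF k(2)[OF \<beta>V[OF that(1)]] k(2)[OF \<beta>V[OF that(2)]], of "fst S" "snd S"]
      k(1)[OF \<beta>V[OF that(1)]] k(1)[OF \<beta>V[OF that(2)]] that(3,4) by simp
  define side where "side S = {v \<in> V. S \<in> \<beta> v}" for S
  define F where "F = side `
    {S \<in> dseps G. sep_order S = l \<and> one_way G (verts (fst S)) (verts (snd S))}"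
  have "separating_family V F"
    unfolding separating_family_def
  proof (intro ballI impI)
    fix u v assume uv: "u \<in> V" "v \<in> V" "u \<noteq> v"
    then obtain A B where S: "(A, B) \<in> dseps G" "sep_order (A, B) = l"
        "distinguishes (A, B) (\<beta> u) (\<beta> v)"
      using assms(3)[of "\<beta> u" "\<beta> v"] \<beta>V \<beta>inj unfolding distinguishable_def by auto
    \<comment> \<open>Swapping the sides gives the orientation that \<open>F\<close>
      requires.\<close>
    have S': "(B, A) \<in> dseps G" "sep_order (B, A) = l" "distinguishes (B, A) (\<beta> u) (\<beta> v)"
      using S dseps_swap sep_order_swap by (auto simp: distinguishes_def)
    consider "one_way G (verts A) (verts B)" | "one_way G (verts B) (verts A)"
      using S(1) by (auto simp: mem_dseps_iff)
    then show "\<exists>X \<in> F. (u \<in> X) \<noteq> (v \<in> X)"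
    proof cases
      case 1
      then have "side (A, B) \<in> F"
        using S by (auto simp: F_def)
      then show ?thesis
        using S uv dist_iff[of u v "(A, B)"] by (intro bexI) (auto simp: side_def)
    next
      case 2
      then have "side (B, A) \<in> F"
        using S' by (auto simp: F_def)
      then show ?thesis
        using S' uv dist_iff[of u v "(B, A)"] by (intro bexI) (auto simp: side_def)
    qed
  qed
  moreover have "X \<inter> Y \<in> F \<and> X \<union> Y \<in> F" if XY: "X \<in> F" "Y \<in> F" "crossing V X Y" for X Y
  proof -
    obtain A B where X: "X = side (A, B)" "(A, B) \<in> dseps G" "sep_order (A, B) = l"
        "one_way G (verts A) (verts B)"
      using XY(1) by (auto simp: F_def)
    obtain C D where Y: "Y = side (C, D)" "(C, D) \<in> dseps G" "sep_order (C, D) = l"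
        "one_way G (verts C) (verts D)"
      using XY(2) by (auto simp: F_def)
    interpret corner_pair G A B C D
      using X Y assms(1) by (intro corner_pair.intro)
    have P: "(PA, PB) \<in> \<beta> v \<longleftrightarrow> v \<in> X \<inter> Y" if "v \<in> V" "sep_order (PA, PB) \<le> l" for v
      using corners_mem_tangle_iff(1)[OF k(2)[OF \<beta>V[OF that(1)]]] k(1)[OF \<beta>V[OF that(1)]] that X Y
      by (auto simp: side_def)
    have Q: "(QA, QB) \<in> \<beta> v \<longleftrightarrow> v \<in> X \<union> Y" if "v \<in> V" "sep_order (QA, QB) \<le> l" for v
      using corners_mem_tangle_iff(2)[OF k(2)[OF \<beta>V[OF that(1)]]] k(1)[OF \<beta>V[OF that(1)]] that X Y
      by (auto simp: side_def)
    have sub: "X \<subseteq> V" "Y \<subseteq> V"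
      using X Y by (auto simp: side_def)
    \<comment> \<open>Both corners, if of order at most \<open>l\<close>, distinguish the tangles of
      this one pair \<open>u\<close>, \<open>v\<close>.\<close>
    then obtain u v where uv: "u \<in> V" "u \<in> X \<inter> Y" "v \<in> V" "v \<notin> X \<union> Y"
      using XY(3) unfolding crossing_def by blast
    then have ne: "\<beta> u \<in> TT" "\<beta> v \<in> TT" "\<beta> u \<noteq> \<beta> v"
      using \<beta>V \<beta>inj by auto
    have "l \<le> sep_order (PA, PB)"
      using min_order[OF ne corners_mem_dseps(1)] dist_iff[OF uv(1,3) corners_mem_dseps(1)] P uv
      by (meson IntE UnCI nat_le_linear)
    moreover have "l \<le> sep_order (QA, QB)"
      using min_order[OF ne corners_mem_dseps(2)] dist_iff[OF uv(1,3) corners_mem_dseps(2)] Q uv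
      by (meson IntE UnCI nat_le_linear)
    \<comment> \<open>Both orders are at least \<open>l\<close>, and by submodularity their sum is
      at most \<open>2 * l\<close>.\<close>
    ultimately have o: "sep_order (PA, PB) = l" "sep_order (QA, QB) = l"
      using corner_orders X(3) Y(3) by linarith+
    have "X \<inter> Y = side (PA, PB)" "X \<union> Y = side (QA, QB)"
      using P Q o sub by (auto simp: side_def)
    then show ?thesis
      using o corners_mem_dseps one_way_corners by (auto simp: F_def)
  qed
  moreover have "finite V" "F \<subseteq> Pow V"
    by (auto simp: V_def F_def side_def)
  ultimately obtain N where N: "N \<subseteq> F" "nested_family V N" "separating_family V N"
    using maximal_nested_separating[of V F] by blast
  have "finite N"
    using N(1) \<open>F \<subseteq> Pow V\<close> \<open>finite V\<close> by (meson finite_Pow_iff finite_subset)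
  then obtain E c where E: "\<forall>e \<in> E. e \<subseteq> V \<and> card e = 2"
    and conn: "\<forall>u \<in> V. \<forall>v \<in> V. (u, v) \<in> {(u, v). {u, v} \<in> E}\<^sup>*"
    and cN: "\<forall>e \<in> E. c e \<in> N"
    and cuts: "\<forall>e \<in> E. \<forall>u v. {u, v} \<in> E \<longrightarrow> ((u \<in> c e) \<noteq> (v \<in> c e)) = ({u, v} = e)"
    by (rule nested_separating_tree[OF _ N(2,3)])
  have cut: "((u \<in> c e) \<noteq> (v \<in> c e)) = ({u, v} = e)" if "e \<in> E" "{u, v} \<in> E" for e u v
    using cuts that by simp
  have "\<exists>S. S \<in> dseps G \<and> sep_order S = l \<and> c e = side S" if "e \<in> E" for e
  proof -
    have "c e \<in> F"
      using cN N(1) that by blast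
    then show ?thesis
      unfolding F_def by blast
  qed
  then obtain \<gamma> where \<gamma>: "\<And>e. e \<in> E \<Longrightarrow> \<gamma> e \<in> dseps G \<and> sep_order (\<gamma> e) = l \<and> c e = side (\<gamma> e)"
    by metis
  have tree: "utree V E"
    using utree_if_cuts[OF \<open>finite V\<close> E conn cut] .
  have mind: "min_distinguisher G (\<gamma> e) (\<beta> u) (\<beta> v)"
    if "e \<in> E" "u \<in> V" "v \<in> V" "(u \<in> c e) \<noteq> (v \<in> c e)" for e u v
  proof -
    have "distinguishes (\<gamma> e) (\<beta> u) (\<beta> v)"
      using dist_iff[of u v "\<gamma> e"] \<gamma>[OF that(1)] that by (auto simp: side_def)
    moreover have "u \<noteq> v"
      using that(4) by blast
    ultimately show ?thesis
      using \<gamma>[OF that(1)] min_order \<beta>V \<beta>inj that(2,3) unfolding min_distinguisher_def by metis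
  qed
  \<comment> \<open>All labels have order \<open>l\<close>, so every edge of a path attains the
    minimum and has to be treated.\<close>
  have paths: "min_distinguisher G (\<gamma> e) (\<beta> u) (\<beta> v)"
    if uv: "u \<in> V" "v \<in> V" "upath V E u p v" and e: "e \<in> walk_edges p" for u v p e
  proof -
    have "e \<in> E"
      using uv e by (auto simp: upath_def)
    moreover have "((hd p \<in> c e) \<noteq> (last p \<in> c e)) = (e \<in> walk_edges p)"
    proof (rule path_crosses_cut_iff)
      fix x y assume "{x, y} \<in> walk_edges p"
      then show "((x \<in> c e) \<noteq> (y \<in> c e)) = ({x, y} = e)"
        using cut[OF \<open>e \<in> E\<close>] uv(3) by (auto simp only: upath_def)
    qed (use uv in \<open>auto simp: upath_def\<close>)
    ultimately show ?thesis
      using mind uv e by (auto simp: upath_def)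
  qed
  \<comment> \<open>The ends of the edge serve as witnesses, each in its own component by a
    one-vertex path.\<close>
  have edges: "\<exists>t \<in> ucomponent V (E - {{s, s'}}) s. \<exists>t' \<in> ucomponent V (E - {{s, s'}}) s'.
      min_distinguisher G (\<gamma> {s, s'}) (\<beta> t) (\<beta> t')" if "{s, s'} \<in> E" for s s'
  proof -
    have ss: "s \<in> V" "s' \<in> V"
      using E that by auto
    have "x \<in> ucomponent V E' x" if "x \<in> V" for x E'
    proof -
      have "upath V E' x [x] x"
        using that by (simp add: upath_def)
      then show ?thesis
        unfolding ucomponent_def by blast
    qed
    moreover have "min_distinguisher G (\<gamma> {s, s'}) (\<beta> s) (\<beta> s')"
      using mind that ss cut[OF that that] by blast
    ultimately show ?thesis
      using ss by blast
  qed
  have "tree_labelling G TT V E \<beta> \<gamma>"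
    unfolding tree_labelling_def
    using tree \<gamma> \<beta>[folded V_def] paths edges by blast
  then show ?thesis
    using \<gamma> by blast
qed

end
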